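(* Let $a\ge2$ be an integer, $K$ a field, and suppose $F\in K[[q]]$ satisfies $$F(q)=1-q+f_sq^s+O(q^{s+1}),\qquad s\ge2,\quad f_s\ne0.$$ Then for $\ell\ge0$, $$C_{2\ell+1}(q)=(-f_s)^\ell q^{a(s+1)\ell+1}+O(q^{a(s+1)\ell+2}),$$ $$C_{2\ell+2}(q)=f_s(-f_s)^\ell q^{a(s+1)\ell+a+s}+O(q^{a(s+1)\ell+a+s+1}).$$ Consequently, $$P_{2\ell+1}-T=(-f_s)^\ell q^{a(s+3)\ell+2}+O(q^{a(s+3)\ell+3})\quad(\ell\ge1),$$ $$P_{2\ell+2}-T=f_s(-f_s)^\ell q^{a(s+3)\ell+2a+s+1}+O(q^{a(s+3)\ell+2a+s+2})\quad(\ell\ge0).$$ All displayed leading coefficients are nonzero. Moreover, if $K$ is replaced by an arbitrary commutative ring, the four displayed identities remain valid, also when $f_s=0$, without the nonvanishing assertion.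
   Context: For a commutative ring $K$, a series $F(q)=1+\sum_{n\ge1}f_nq^n\in K[[q]]$ and an integer $a\ge2$, define $C_m(q)\in K[[q]]$ by $$\frac{\sum_{m\ge0}X^mF(q^{am+1})}{\sum_{m\ge0}X^mF(q^{a(m+1)})}=\sum_{m\ge0}C_m(q)X^m\quad\text{in }K[[q]][[X]],$$ and for $d\ge1$ $$P_d(q)=q^{1-a}\sum_{j\ge0}C_{jd}(q)q^{ajd},\qquad T(q)=q^{1-a}\frac{F(q)}{F(q^a)}.$$ $O(q^n)$ means divisible by $q^n$ as a formal power series. *)

theory Defs
  imports "HOL-Computational_Algebra.Formal_Laurent_Series"
begin

text \<open>
  The quotient \<open>f / g\<close> in an arbitrary commutative ring. It is only meant for a unit \<open>g\<close>, where
  the element described below is unique. The division of the class \<^class>\<open>inverse\<close> is not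
  available on power series over a commutative ring, nor on power series over such series.
\<close>
definition ring_quot :: "'a::comm_ring_1 \<Rightarrow> 'a \<Rightarrow> 'a" where
  "ring_quot f g = (THE h. h * g = f)"

lemma ring_quot_eqI:
  assumes "g dvd 1" and "h * g = f"
  shows "ring_quot f g = h"
  unfolding ring_quot_def
proof (rule the_equality)
  from assms(1) obtain u where u: "g * u = 1" by (metis dvdE)
  fix h' assume "h' * g = f"
  then have "h' * (g * u) = h * (g * u)" by (simp add: assms(2) mult.assoc [symmetric])
  then show "h' = h" by (simp add: u)
qed (fact assms(2))

lemma ring_quot_mult:
  assumes "g dvd 1"
  shows "ring_quot f g * g = f"
proof -
  from assms obtain u where u: "g * u = 1" by (metis dvdE)
  have "f * u * g = f" using u by (simp add: mult.assoc mult.commute [of u g])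
  with ring_quot_eqI [OF assms this] show ?thesis by simp
qed

lemma fps_dvd_1I:
  fixes f :: "'a::comm_ring_1 fps"
  assumes "fps_nth f 0 dvd 1"
  shows "f dvd 1"
proof -
  from assms obtain y where "fps_nth f 0 * y = 1" by (metis dvdE)
  from fps_right_inverse [OF this] show ?thesis by (metis dvdI)
qed

text \<open>\<open>F(q\<^sup>n)\<close>, for \<open>n \<ge> 1\<close>.\<close>
abbreviation at_qpow :: "'a::comm_ring_1 fps \<Rightarrow> nat \<Rightarrow> 'a fps" where
  "at_qpow F n \<equiv> fps_compose F (fps_X ^ n)"

text \<open>
  Elements of \<open>K[[q]][[X]]\<close> have type \<^typ>\<open>'a fps fps\<close>: the outer variable is \<open>X\<close>, the inner
  one is \<open>q\<close>.
\<close>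
definition C_num :: "nat \<Rightarrow> 'a::comm_ring_1 fps \<Rightarrow> 'a fps fps" where
  "C_num a F = Abs_fps (\<lambda>m. at_qpow F (a * m + 1))"

definition C_den :: "nat \<Rightarrow> 'a::comm_ring_1 fps \<Rightarrow> 'a fps fps" where
  "C_den a F = Abs_fps (\<lambda>m. at_qpow F (a * (m + 1)))"

definition Cser :: "nat \<Rightarrow> 'a::comm_ring_1 fps \<Rightarrow> nat \<Rightarrow> 'a fps" where
  "Cser a F m = fps_nth (ring_quot (C_num a F) (C_den a F)) m"

lemma at_qpow_unit: "fps_nth F 0 = 1 \<Longrightarrow> at_qpow F n dvd 1"
  by (rule fps_dvd_1I) simp

lemma C_den_unit: "fps_nth F 0 = 1 \<Longrightarrow> C_den a F dvd 1"
  by (rule fps_dvd_1I) (simp add: C_den_def at_qpow_unit)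

lemma Cser_series: "fps_nth F 0 = 1 \<Longrightarrow> Abs_fps (Cser a F) * C_den a F = C_num a F"
  using ring_quot_mult [OF C_den_unit, of F "C_num a F" a]
  by (simp add: Cser_def [abs_def] fps_nth_inverse)

text \<open>
  The factor \<open>q\<^bsup>1-a\<^esup>\<close> has a negative exponent, so \<open>P\<^sub>d\<close> and \<open>T\<close> are Laurent series. The
  infinite sum over \<open>j\<close> is a limit in the \<open>q\<close>-adic topology.
\<close>
definition Pser :: "nat \<Rightarrow> 'a::comm_ring_1 fps \<Rightarrow> nat \<Rightarrow> 'a fls" where
  "Pser a F d = fls_X_intpow (1 - int a) *
     fps_to_fls (\<Sum>j. Cser a F (j * d) * fps_X ^ (a * j * d))"

definition Tser :: "nat \<Rightarrow> 'a::comm_ring_1 fps \<Rightarrow> 'a fls" where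
  "Tser a F = fls_X_intpow (1 - int a) * fps_to_fls (ring_quot F (at_qpow F a))"

lemma Pser_summable:
  fixes F :: "'a::comm_ring_1 fps"
  assumes "a \<ge> 1" "d \<ge> 1"
  shows "summable (\<lambda>j. Cser a F (j * d) * fps_X ^ (a * j * d))"
proof -
  let ?t = "\<lambda>j. Cser a F (j * d) * fps_X ^ (a * j * d)"
  have "(\<lambda>N. \<Sum>j<N. ?t j) \<longlonglongrightarrow> Abs_fps (\<lambda>n. \<Sum>j\<le>n. fps_nth (?t j) n)"
  proof (rule tendsto_fpsI)
    fix n
    have "fps_nth (\<Sum>j<N. ?t j) n = (\<Sum>j\<le>n. fps_nth (?t j) n)" if "N > n" for N
    proof -
      have "fps_nth (?t j) n = 0" if "j > n" for j
      proof -
        have "j * 1 \<le> j * (a * d)" using assms by (intro mult_le_mono2) simp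
        also have "\<dots> = a * j * d" by (simp add: mult_ac)
        finally have "n < a * j * d" using that by linarith
        then show ?thesis by (simp add: fps_X_power_mult_right_nth)
      qed
      then have "(\<Sum>j<N. fps_nth (?t j) n) = (\<Sum>j\<le>n. fps_nth (?t j) n)"
        using \<open>N > n\<close> by (intro sum.mono_neutral_right) auto
      then show ?thesis by (simp add: fps_sum_nth)
    qed
    then show "\<forall>\<^sub>F N in sequentially. fps_nth (\<Sum>j<N. ?t j) n =
        fps_nth (Abs_fps (\<lambda>n. \<Sum>j\<le>n. fps_nth (?t j) n)) n"
      unfolding fps_nth_Abs_fps by (rule eventually_mono [OF eventually_gt_at_top [of n]])
  qed
  then show ?thesis by (auto simp: summable_def sums_def)
qed

text \<open>
  \<open>fps_eq_O f g n\<close> means \<open>f = g + O(q\<^sup>n)\<close>. For Laurent series, \<open>O(q\<^sup>n)\<close> still requires the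
  remainder to be a power series that is divisible by \<open>q\<^sup>n\<close> as such.
\<close>
definition fps_eq_O :: "'a::comm_ring_1 fps \<Rightarrow> 'a fps \<Rightarrow> nat \<Rightarrow> bool" where
  "fps_eq_O f g n \<longleftrightarrow> fps_X ^ n dvd (f - g)"

definition fls_eq_O :: "'a::comm_ring_1 fls \<Rightarrow> 'a fls \<Rightarrow> nat \<Rightarrow> bool" where
  "fls_eq_O f g n \<longleftrightarrow> (\<exists>h. f - g = fps_to_fls h \<and> fps_X ^ n dvd h)"

abbreviation qmono :: "'a::comm_ring_1 \<Rightarrow> nat \<Rightarrow> 'a fps" where
  "qmono c n \<equiv> fps_const c * fps_X ^ n"

end

theory Submission
  imports Defs
begin

text \<open>
  After multiplication of numerator and denominator by \<open>(1 - X) (1 - q\<^sup>a X)\<close>, the denominator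
  becomes \<open>F(q\<^sup>a) + O(q\<^bsup>as\<^esup>) X + (f\<^sub>s q\<^bsup>as+a\<^esup> + \<dots>) X\<^sup>2 + \<dots>\<close>, where for \<open>k \<ge> 2\<close> the coefficient of
  \<open>X\<^sup>k\<close> is \<open>O(q\<^bsup>as(k-1)+a\<^esup>)\<close>, and the numerator becomes
  \<open>F(q) + (q + \<dots>) X + (f\<^sub>s q\<^bsup>a+s\<^esup> + \<dots>) X\<^sup>2 + \<dots>\<close> with a remainder that is negligible. In the
  resulting recurrence for \<open>C\<^sub>m\<close>, \<open>m \<ge> 3\<close>, the dominant term is \<open>-f\<^sub>s q\<^bsup>a(s+1)\<^esup> C\<^bsub>m-2\<^esub>\<close>, since the order
  of \<open>C\<^sub>m\<close> grows by less than \<open>as\<close> in each step. As the order is monotone in \<open>m\<close>, the term \<open>j = 1\<close>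
  dominates \<open>P\<^sub>d - T\<close>.
\<close>

section \<open>Leading terms of power series over a commutative ring\<close>

lemma fps_X_power_dvd_iff:
  fixes f :: "'a::comm_ring_1 fps"
  shows "fps_X ^ n dvd f \<longleftrightarrow> (\<forall>i<n. fps_nth f i = 0)"
proof
  assume "fps_X ^ n dvd f"
  then obtain g where "f = fps_X ^ n * g" by (rule dvdE)
  then show "\<forall>i<n. fps_nth f i = 0" by (simp add: fps_X_power_mult_nth)
next
  assume "\<forall>i<n. fps_nth f i = 0"
  then have "f = fps_X ^ n * fps_shift n f"
    by (intro fps_ext) (simp add: fps_X_power_mult_nth)
  then show "fps_X ^ n dvd f" by (rule dvdI)
qed

lemma fps_X_power_dvd_mult:
  fixes f g :: "'a::comm_ring_1 fps"
  assumes "fps_X ^ i dvd f" "fps_X ^ j dvd g" "n \<le> i + j"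
  shows "fps_X ^ n dvd f * g"
proof -
  have "fps_X ^ n dvd (fps_X ^ (i + j) :: 'a fps)" by (rule le_imp_power_dvd) fact
  also have "\<dots> dvd f * g" unfolding power_add by (rule mult_dvd_mono) fact+
  finally show ?thesis .
qed

lemma fps_X_power_dvd_mono:
  fixes f :: "'a::comm_ring_1 fps"
  shows "fps_X ^ m dvd f \<Longrightarrow> n \<le> m \<Longrightarrow> fps_X ^ n dvd f"
  by (metis dvd_trans le_imp_power_dvd)

lemma fps_eq_O_diff:
  "fps_eq_O f g n \<Longrightarrow> fps_eq_O f' g' n \<Longrightarrow> fps_eq_O (f - f') (g - g') n"
  unfolding fps_eq_O_def by (drule (1) dvd_diff) (simp add: algebra_simps)

lemma fps_eq_O_absorb:
  "fps_eq_O f g n \<Longrightarrow> fps_X ^ n dvd h \<Longrightarrow> fps_eq_O (f + h) g n"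
  unfolding fps_eq_O_def by (drule (1) dvd_add) (simp add: algebra_simps)

text \<open>The coefficient \<open>c\<close> may be zero, so a leading term is recorded by vanishing
  below \<open>n\<close> and the value at \<open>n\<close>, not by an exact order. This covers f_s =
  0 and zero divisors.\<close>

lemma fps_eq_O_qmono_iff:
  "fps_eq_O f (qmono c n) (Suc n) \<longleftrightarrow> fps_X ^ n dvd f \<and> fps_nth f n = c"
  unfolding fps_eq_O_def fps_X_power_dvd_iff less_Suc_eq
  by (auto simp: fps_X_power_mult_right_nth)

lemma fps_eq_O_qmono_mult:
  assumes "fps_eq_O f (qmono c m) (Suc m)" "fps_eq_O g (qmono d n) (Suc n)"
  shows "fps_eq_O (f * g) (qmono (c * d) (m + n)) (Suc (m + n))"
proof -
  from assms obtain f' g' where fg: "f = fps_X ^ m * f'" "g = fps_X ^ n * g'"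
      and "fps_nth f m = c" "fps_nth g n = d"
    unfolding fps_eq_O_qmono_iff by (auto elim!: dvdE)
  then have cd: "fps_nth f' 0 = c" "fps_nth g' 0 = d" by (simp_all add: fps_X_power_mult_nth)
  have "f * g = fps_X ^ (m + n) * (f' * g')" by (simp add: fg power_add mult_ac)
  then show ?thesis by (simp add: fps_eq_O_qmono_iff fps_X_power_mult_nth cd)
qed

text \<open>Serves to divide the recurrence for C_m by F(q^a): the inverse of \<open>g\<close> also
  has constant coefficient 1, so the leading term is unchanged.\<close>

lemma fps_eq_O_qmono_cancel_unit:
  assumes "fps_eq_O (h * g) (qmono c n) (Suc n)" and g0: "fps_nth g 0 = 1"
  shows "fps_eq_O h (qmono c n) (Suc n)"
proof -
  from g0 have "g dvd 1" by (intro fps_dvd_1I) simp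
  then obtain u where u: "g * u = 1" by (metis dvdE)
  have "fps_nth (g * u) 0 = 1" by (simp add: u)
  with g0 have "fps_eq_O u (qmono 1 0) (Suc 0)" unfolding fps_eq_O_qmono_iff by simp
  from fps_eq_O_qmono_mult [OF assms(1) this] show ?thesis by (simp add: u mult.assoc)
qed

section \<open>Substitution of q^n into F\<close>

lemma at_qpow_nth:
  assumes "n \<ge> 1"
  shows "fps_nth (at_qpow F n) k = (if n dvd k then fps_nth F (k div n) else 0)"
proof -
  have "fps_nth (at_qpow F n) k = (\<Sum>i=0..k. if k = n * i then fps_nth F i else 0)"
    unfolding fps_compose_nth by (intro sum.cong refl) (simp add: power_mult [symmetric])
  also have "\<dots> = (\<Sum>i=0..k. if n dvd k \<and> i = k div n then fps_nth F i else 0)"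
    using assms by (intro sum.cong refl) auto
  also have "\<dots> = (if n dvd k then fps_nth F (k div n) else 0)"
    by (cases "n dvd k") simp_all
  finally show ?thesis .
qed

text \<open>Only multiples of \<open>n\<close> occur as exponents in F(q^n), and those up to
  \<open>s * n\<close> come from coefficients of F of index at most \<open>s\<close>, which are
  known.\<close>

lemma at_qpow_expansion:
  assumes F: "fps_eq_O F (1 - fps_X + qmono f s) (s + 1)" and "s \<ge> 2" "n \<ge> 1"
  shows "fps_eq_O (at_qpow F n - 1 + fps_X ^ n) (qmono f (s * n)) (Suc (s * n))"
proof -
  have Fn: "fps_nth F i = (if i = 0 then 1 else if i = 1 then - 1 else if i = s then f else 0)"
    if "i \<le> s" for i
  proof -
    from F that have "fps_nth (F - (1 - fps_X + qmono f s)) i = 0"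
      unfolding fps_eq_O_def fps_X_power_dvd_iff by simp
    with \<open>s \<ge> 2\<close> show ?thesis by (auto simp: fps_X_power_mult_right_nth)
  qed
  have "fps_nth (at_qpow F n - 1 + fps_X ^ n) k = (if k = s * n then f else 0)"
    if "k \<le> s * n" for k
  proof (cases "n dvd k")
    case True
    then obtain i where k: "k = n * i" by (rule dvdE)
    with that \<open>n \<ge> 1\<close> have "i \<le> s" by (simp add: mult.commute)
    then show ?thesis using \<open>n \<ge> 1\<close> \<open>s \<ge> 2\<close> by (auto simp: k at_qpow_nth Fn)
  next
    case False
    then have "k \<noteq> 0" "k \<noteq> n" "k \<noteq> s * n" by (metis dvd_0_right, auto)
    with False show ?thesis using \<open>n \<ge> 1\<close> by (simp add: at_qpow_nth)
  qed
  then show ?thesis unfolding fps_eq_O_qmono_iff fps_X_power_dvd_iff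
    by (metis order_less_imp_le order_less_irrefl order_refl)
qed

text \<open>Multiplication by \<open>(1 - X) (1 - q\<^sup>a X)\<close> kills the poles of numerator and denominator at
  \<open>X = 1\<close> and \<open>X = q\<^bsup>-a\<^esup>\<close>, which come from the terms \<open>1 - q\<close> of \<open>F\<close>.\<close>
definition clear_poles :: "nat \<Rightarrow> 'a::comm_ring_1 fps fps \<Rightarrow> 'a fps fps" where
  "clear_poles a U = (1 - fps_X) * (1 - fps_const (fps_X ^ a) * fps_X) * U"

lemma clear_poles_alt:
  "clear_poles a U = U - fps_const (1 + fps_X ^ a) * (fps_X * U) +
     fps_const (fps_X ^ a) * (fps_X * (fps_X * U))"
proof -
  have "clear_poles a U = U - (1 + fps_const (fps_X ^ a)) * (fps_X * U) +
      fps_const (fps_X ^ a) * (fps_X * (fps_X * U))"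
    unfolding clear_poles_def by (simp add: algebra_simps)
  then show ?thesis unfolding fps_const_add [symmetric] fps_const_1_eq_1 .
qed

lemma clear_poles_nth:
  "fps_nth (clear_poles a U) 0 = fps_nth U 0"
  "fps_nth (clear_poles a U) (Suc 0) = fps_nth U (Suc 0) - (1 + fps_X ^ a) * fps_nth U 0"
  "fps_nth (clear_poles a U) (Suc (Suc m)) = fps_nth U (Suc (Suc m)) -
     (1 + fps_X ^ a) * fps_nth U (Suc m) + fps_X ^ a * fps_nth U m"
  by (simp_all add: clear_poles_alt)

text \<open>The order and the leading coefficient of \<open>C\<^sub>m\<close> for \<open>m \<ge> 1\<close>. At \<open>m = 0\<close> they do not follow
  the pattern of period two.\<close>
fun Cord :: "nat \<Rightarrow> nat \<Rightarrow> nat \<Rightarrow> nat" where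
  "Cord a s 0 = 0"
| "Cord a s (Suc 0) = 1"
| "Cord a s (Suc (Suc 0)) = a + s"
| "Cord a s (Suc (Suc (Suc m))) = Cord a s (Suc m) + a * (s + 1)"

fun Clead :: "'a::comm_ring_1 \<Rightarrow> nat \<Rightarrow> 'a" where
  "Clead f 0 = 1"
| "Clead f (Suc 0) = 1"
| "Clead f (Suc (Suc 0)) = f"
| "Clead f (Suc (Suc (Suc m))) = - f * Clead f (Suc m)"

section \<open>Growth of the expected orders\<close>

lemma Cord_odd: "Cord a s (2 * l + 1) = a * (s + 1) * l + 1"
  by (induction l) (simp_all add: algebra_simps)

lemma Cord_even: "Cord a s (2 * l + 2) = a * (s + 1) * l + a + s"
  by (induction l) (simp_all add: algebra_simps)

lemma Clead_odd: "Clead f (2 * l + 1) = (- f) ^ l"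
  by (induction l) simp_all

lemma Clead_even: "Clead f (2 * l + 2) = f * (- f) ^ l"
  by (induction l) simp_all

lemma add_less_mult_nat: "a \<ge> 2 \<Longrightarrow> s \<ge> 2 \<Longrightarrow> a + s < a * s + (1::nat)"
proof -
  assume "a \<ge> 2" "s \<ge> 2"
  then obtain x y where "a = x + 2" "s = y + 2" by (metis le_add_diff_inverse2)
  then show ?thesis by simp
qed

text \<open>The first increment is 1; afterwards increments alternate between a + s - 1 and a s - s
  + 1. The former is below a s because (a - 1)(s - 1) > 0, the latter because s > 1.\<close>

lemma Cord_step:
  assumes "a \<ge> 2" "s \<ge> 2"
  shows "Cord a s m \<le> Cord a s (Suc m) \<and> Cord a s (Suc m) < Cord a s m + a * s"
proof (induction m rule: induct_nat_012)
  case (ge2 m)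
  then show ?case using assms add_less_mult_nat [OF assms]
    by (cases m) (simp_all add: algebra_simps)
qed (use assms add_less_mult_nat [OF assms] in auto)

lemma Cord_mono: "a \<ge> 2 \<Longrightarrow> s \<ge> 2 \<Longrightarrow> m \<le> n \<Longrightarrow> Cord a s m \<le> Cord a s n"
  by (rule lift_Suc_mono_le) (simp_all add: Cord_step)

lemma Cord_add_less:
  assumes "a \<ge> 2" "s \<ge> 2"
  shows "Cord a s (m + Suc k) < Cord a s m + Suc k * (a * s)"
proof (induction k)
  case 0
  then show ?case using Cord_step [OF assms, of m] by simp
next
  case (Suc k)
  then show ?case using Cord_step [OF assms, of "m + Suc k"] by simp
qed

text \<open>Equality holds for \<open>m\<close> at least 1 by the recursion; \<open>m = 0\<close>
  lies outside the period and leaves only a bound.\<close>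

lemma Cord_add2: "a \<ge> 2 \<Longrightarrow> s \<ge> 2 \<Longrightarrow> Cord a s (Suc (Suc m)) \<le> Cord a s m + a * s + a"
  using add_less_mult_nat [of a s] by (cases m) (simp_all add: algebra_simps)

lemma C_num_Abs: "C_num a F = Abs_fps (\<lambda>m. at_qpow F (a * m + 1))"
  by (simp add: C_num_def)

lemma C_den_Abs: "C_den a F = Abs_fps (\<lambda>m. at_qpow F (a * m + a))"
  by (simp add: C_den_def algebra_simps)

section \<open>Cleared numerator and denominator\<close>

context
  fixes a s :: nat and F :: "'a::comm_ring_1 fps" and f :: 'a
  assumes a: "a \<ge> 2" and s: "s \<ge> 2" and F: "fps_eq_O F (1 - fps_X + qmono f s) (s + 1)"
begin

lemma F_nth_0: "fps_nth F 0 = 1"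
proof -
  from F have "fps_nth (F - (1 - fps_X + qmono f s)) 0 = 0"
    unfolding fps_eq_O_def fps_X_power_dvd_iff by simp
  with s show ?thesis by simp
qed

private definition F_tail :: "nat \<Rightarrow> 'a fps" where
  "F_tail n = at_qpow F n - 1 + fps_X ^ n"

private lemma F_tail_lead: "n \<ge> 1 \<Longrightarrow> fps_eq_O (F_tail n) (qmono f (s * n)) (Suc (s * n))"
  unfolding F_tail_def by (rule at_qpow_expansion [OF F s])

private lemma F_tail_dvd: "n \<ge> 1 \<Longrightarrow> k \<le> s * n \<Longrightarrow> fps_X ^ k dvd F_tail n"
  by (rule fps_X_power_dvd_mono [where m = "s * n"]) (use F_tail_lead fps_eq_O_qmono_iff in auto)

text \<open>The denominator is the case \<open>r = a\<close>, the numerator the case \<open>r = 1\<close>.\<close>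
private definition cleared :: "nat \<Rightarrow> nat \<Rightarrow> 'a fps" where
  "cleared r = fps_nth (clear_poles a (Abs_fps (\<lambda>m. at_qpow F (a * m + r))))"

private lemma cleared_0: "cleared r 0 = at_qpow F r"
  by (simp add: cleared_def clear_poles_nth)

text \<open>The terms 1 - q of F contribute (1 - q^r) + (q^r - q^a) X after clearing. The
  coefficient of X thus vanishes for the denominator and starts with q for the numerator; from X^2
  on only tails remain.\<close>

private lemma cleared_1: "cleared r (Suc 0) = F_tail (a + r) - (1 + fps_X ^ a) * F_tail r + fps_X ^ r - fps_X ^ a"
  by (simp add: cleared_def clear_poles_nth F_tail_def algebra_simps power_add)

private lemma cleared_add2: "cleared r (Suc (Suc m)) =
    F_tail (a * (m + 2) + r) - (1 + fps_X ^ a) * F_tail (a * (m + 1) + r) + fps_X ^ a * F_tail (a * m + r)"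
  by (simp add: cleared_def clear_poles_nth F_tail_def algebra_simps power_add)

text \<open>As a s > a, these two tails vanish beyond the bound a + s (a m + r) for the remaining
  term \<open>fps_X ^ a * F_tail (a * m + r)\<close>. The extra 1 lets that term determine the
  leading coefficient.\<close>

private lemma cleared_add2_tail_dvd:
  assumes "r \<ge> 1" "k \<le> s * r + a + a * s * m + 1"
  shows "fps_X ^ k dvd F_tail (a * (m + 2) + r) - (1 + fps_X ^ a) * F_tail (a * (m + 1) + r)"
proof (intro dvd_diff dvd_mult F_tail_dvd)
  have "a * 2 \<le> a * s" using s by (rule mult_le_mono2)
  with a have *: "a + 1 \<le> a * s" by linarith
  with assms(2) show "k \<le> s * (a * (m + 1) + r)" by (simp add: algebra_simps)
  with * show "k \<le> s * (a * (m + 2) + r)" by (simp add: algebra_simps)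
qed (use assms in auto)

private lemma cleared_add2_dvd:
  assumes "r \<ge> 1"
  shows "fps_X ^ (s * r + a + a * s * m) dvd cleared r (Suc (Suc m))"
  unfolding cleared_add2
proof (rule dvd_add)
  show "fps_X ^ (s * r + a + a * s * m) dvd
      F_tail (a * (m + 2) + r) - (1 + fps_X ^ a) * F_tail (a * (m + 1) + r)"
    using assms by (intro cleared_add2_tail_dvd) simp_all
  have "fps_X ^ (s * (a * m + r)) dvd F_tail (a * m + r)" using assms by (intro F_tail_dvd) simp_all
  with dvd_refl show "fps_X ^ (s * r + a + a * s * m) dvd fps_X ^ a * F_tail (a * m + r)"
    by (rule fps_X_power_dvd_mult) (simp add: algebra_simps)
qed

text \<open>The case r = a drives the recurrence of period two; the case r = 1 supplies the leading
  term of C_2.\<close>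

private lemma cleared_2_lead:
  assumes "r \<ge> 1"
  shows "fps_eq_O (cleared r (Suc (Suc 0))) (qmono f (a + s * r)) (Suc (a + s * r))"
proof -
  have "fps_eq_O (fps_X ^ a) (qmono (1::'a) a) (Suc a)"
    unfolding fps_eq_O_qmono_iff by simp
  from fps_eq_O_qmono_mult [OF this F_tail_lead [OF assms]]
  have "fps_eq_O (fps_X ^ a * F_tail r) (qmono f (a + s * r)) (Suc (a + s * r))" by simp
  moreover have "fps_X ^ Suc (a + s * r) dvd
      F_tail (a * (0 + 2) + r) - (1 + fps_X ^ a) * F_tail (a * (0 + 1) + r)"
    using assms by (intro cleared_add2_tail_dvd) auto
  ultimately have "fps_eq_O (fps_X ^ a * F_tail r +
      (F_tail (a * (0 + 2) + r) - (1 + fps_X ^ a) * F_tail (a * (0 + 1) + r)))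
      (qmono f (a + s * r)) (Suc (a + s * r))" by (rule fps_eq_O_absorb)
  then show ?thesis by (simp add: cleared_add2 add.commute)
qed

private lemma cleared_den_1_dvd: "fps_X ^ (a * s) dvd cleared a (Suc 0)"
  unfolding cleared_1 using a by (simp, intro dvd_diff dvd_mult F_tail_dvd) (simp_all add: algebra_simps)

private lemma cleared_num_1_lead: "fps_eq_O (cleared 1 (Suc 0)) (qmono 1 1) (Suc 1)"
proof -
  have "fps_X ^ Suc 1 dvd F_tail (a + 1) - (1 + fps_X ^ a) * F_tail 1 - fps_X ^ a"
    using a s by (intro dvd_diff dvd_mult F_tail_dvd le_imp_power_dvd) simp_all
  moreover have "fps_eq_O fps_X (qmono (1::'a) 1) (Suc 1)"
    by (simp add: fps_eq_O_def)
  ultimately show ?thesis by (drule_tac fps_eq_O_absorb) (auto simp: cleared_1 algebra_simps)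
qed

section \<open>The recurrence and the leading terms of C_m\<close>

private lemma Cser_recurrence: "(\<Sum>i\<le>m. Cser a F i * cleared a (m - i)) = cleared 1 m"
proof -
  \<comment> \<open>Clearing multiplies both sides of the defining relation by a common factor, so
    the relation survives.\<close>
  have "Abs_fps (Cser a F) * clear_poles a (C_den a F) = clear_poles a (C_num a F)"
    unfolding Cser_series [OF F_nth_0, of a, symmetric] clear_poles_def by (simp add: mult_ac)
  then have "fps_nth (Abs_fps (Cser a F) * clear_poles a (C_den a F)) m =
      fps_nth (clear_poles a (C_num a F)) m" by simp
  then show ?thesis
    by (simp add: fps_mult_nth cleared_def C_num_Abs C_den_Abs atMost_atLeast0)
qed

text \<open>For m >= 3 the numerator is negligible: it is divisible by q to the power s + a + a s (m
  - 2), while \<open>Cord\<close> is a + s at m = 2 and gains less than a s per step.\<close>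

private lemma cleared_num_lead:
  assumes "m \<ge> 1"
  shows "fps_eq_O (cleared 1 m) (if m \<le> 2 then qmono (Clead f m) (Cord a s m) else 0) (Suc (Cord a s m))"
proof -
  consider "m = 1" | "m = 2" | "m \<ge> 3" using assms by linarith
  then show ?thesis
  proof cases
    case 1
    then show ?thesis using cleared_num_1_lead by simp
  next
    case 2
    then show ?thesis using cleared_2_lead [of 1] by (simp add: numeral_2_eq_2)
  next
    case 3
    define k where "k = m - 3"
    with 3 have m: "m = k + 3" by simp
    have *: "Cord a s (k + 3) < s + a + a * s * (k + 1)"
    proof -
      have "Cord a s (k + 3) < Cord a s 2 + Suc k * (a * s)"
        using Cord_add_less [OF a s, of 2 k] by (simp add: numeral_3_eq_3 numeral_2_eq_2)
      then show ?thesis by (simp add: numeral_2_eq_2 algebra_simps)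
    qed
    have "fps_X ^ Suc (Cord a s m) dvd cleared 1 m"
      using cleared_add2_dvd [of 1 "k + 1"] *
      by (rule_tac fps_X_power_dvd_mono [where m = "s + a + a * s * (k + 1)"])
        (simp_all add: m numeral_3_eq_3)
    then show ?thesis by (simp add: m fps_eq_O_def)
  qed
qed

text \<open>The recurrence is solved for C_m F(q^a). For m <= 2 the numerator gives the leading
  term; from m = 3 on the summand i = m - 2 does, and moving it to the other side gives the sign in
  \<open>Clead\<close>.\<close>

lemma Cser_lead:
  "m \<ge> 1 \<Longrightarrow> fps_eq_O (Cser a F m) (qmono (Clead f m) (Cord a s m)) (Suc (Cord a s m))"
proof (induction m rule: less_induct)
  case (less m)
  let ?w = "Cord a s"
  \<comment> \<open>The index 0 lies outside the induction hypothesis, but its order bound is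
    0.\<close>
  have C_dvd: "fps_X ^ ?w i dvd Cser a F i" if "i < m" for i
    using less.IH [of i] that by (cases i) (auto simp: fps_eq_O_qmono_iff)
  \<comment> \<open>The excepted summand i = m - 2 dominates for m >= 3. At m = 2 it has i = 0 and
    is negligible because a s + a > a + s.\<close>
  have small: "fps_X ^ Suc (?w m) dvd Cser a F i * cleared a (m - i)"
    if "i < m" and not2: "m = i + 2 \<Longrightarrow> i = 0" for i
  proof -
    from \<open>i < m\<close> consider "m = Suc i" | "m = i + 2" | "m \<ge> i + 3" by linarith
    then show ?thesis
    proof cases
      case 1
      show ?thesis
        by (rule fps_X_power_dvd_mult [OF C_dvd [OF \<open>i < m\<close>], where j = "a * s"])
          (use 1 cleared_den_1_dvd Cord_step [OF a s, of i] in auto)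
    next
      case 2
      with not2 have "i = 0" "m = 2" by simp_all
      with cleared_add2_dvd [of a 0] a add_less_mult_nat [OF a s] show ?thesis
        by (rule_tac fps_X_power_dvd_mult [OF C_dvd [OF \<open>i < m\<close>], where j = "s * a + a"])
          (simp_all add: numeral_2_eq_2 algebra_simps)
    next
      case 3
      then obtain k where m: "m = i + 3 + k" by (rule le_Suc_ex [THEN exE])
      \<comment> \<open>Two steps cost at most a s + a and the other k + 1 steps less than a s each,
        which together matches the order bound of \<open>cleared a (m - i)\<close>.\<close>
      have "?w m < ?w (i + 2) + Suc k * (a * s)"
        using Cord_add_less [OF a s, of "i + 2" k] by (simp add: m numeral_3_eq_3)
      also have "\<dots> \<le> ?w i + a * s + a + Suc k * (a * s)"
        using Cord_add2 [OF a s, of i] by simp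
      finally have "Suc (?w m) \<le> ?w i + (s * a + a + a * s * Suc k)"
        by (simp add: algebra_simps)
      then show ?thesis
        using cleared_add2_dvd [of a "Suc k"] a
        by (rule_tac fps_X_power_dvd_mult [OF C_dvd [OF \<open>i < m\<close>], where j = "s * a + a + a * s * Suc k"])
          (simp_all add: m numeral_3_eq_3)
    qed
  qed
  have "Cser a F m * cleared a 0 = cleared 1 m - (\<Sum>i<m. Cser a F i * cleared a (m - i))"
    using Cser_recurrence [of m] by (simp add: lessThan_Suc_atMost [symmetric] algebra_simps)
  moreover have "fps_eq_O (cleared 1 m - (\<Sum>i<m. Cser a F i * cleared a (m - i)))
      (qmono (Clead f m) (?w m)) (Suc (?w m))"
  proof (cases "m \<le> 2")
    case True
    then have "fps_eq_O (\<Sum>i<m. Cser a F i * cleared a (m - i)) 0 (Suc (?w m))"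
      unfolding fps_eq_O_def diff_zero by (intro dvd_sum small) auto
    from fps_eq_O_diff [OF cleared_num_lead [OF less.prems] this] True show ?thesis by simp
  next
    case False
    define k where "k = m - 3"
    with False have m: "m = Suc (Suc (Suc k))" by simp
    have "fps_eq_O (Cser a F (Suc k)) (qmono (Clead f (Suc k)) (?w (Suc k))) (Suc (?w (Suc k)))"
      by (rule less.IH) (simp_all add: m)
    from fps_eq_O_qmono_mult [OF this cleared_2_lead [of a]] a
    have "fps_eq_O (Cser a F (Suc k) * cleared a 2) (qmono (- Clead f m) (?w m)) (Suc (?w m))"
      by (simp add: m numeral_2_eq_2 algebra_simps)
    moreover have "fps_X ^ Suc (?w m) dvd (\<Sum>i\<in>{..<m} - {Suc k}. Cser a F i * cleared a (m - i))"
      by (intro dvd_sum small) (auto simp: m)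
    ultimately have "fps_eq_O (\<Sum>i<m. Cser a F i * cleared a (m - i)) (qmono (- Clead f m) (?w m)) (Suc (?w m))"
      by (subst sum.remove [of _ "Suc k"]) (auto simp: m numeral_2_eq_2 intro!: fps_eq_O_absorb)
    from fps_eq_O_diff [OF cleared_num_lead [OF less.prems] this] False
    show ?thesis by (simp flip: fps_const_neg)
  qed
  ultimately have "fps_eq_O (Cser a F m * cleared a 0) (qmono (Clead f m) (?w m)) (Suc (?w m))" by simp
  then show ?case by (rule fps_eq_O_qmono_cancel_unit) (simp add: cleared_0 F_nth_0)
qed

section \<open>Comparison of P_d with T\<close>

lemma Cser_0: "Cser a F 0 = ring_quot F (at_qpow F a)"
proof (rule ring_quot_eqI [symmetric])
  show "at_qpow F a dvd 1" by (rule at_qpow_unit) (rule F_nth_0)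
  show "Cser a F 0 * at_qpow F a = F"
    using Cser_recurrence [of 0] unfolding cleared_0 power_one_right fps_compose_fps_X by (simp add: cleared_0)
qed

text \<open>The summand j = 0 is T by \<open>Cser_0\<close>. The term from j = 1 lies below the
  bounds for all j >= 2, since \<open>Cord\<close> is monotone and a j d grows strictly with
  j.\<close>

lemma Pser_minus_Tser:
  assumes "d \<ge> 1"
  shows "fls_eq_O (Pser a F d - Tser a F) (fps_to_fls (qmono (Clead f d) (Cord a s d + a * d + 1 - a)))
    (Suc (Cord a s d + a * d + 1 - a))"
proof -
  let ?t = "\<lambda>j. Cser a F (j * d) * fps_X ^ (a * j * d)" and ?M = "Cord a s d + a * d"
  have "(\<lambda>N. \<Sum>j<N. ?t j) \<longlonglongrightarrow> suminf ?t"
    using Pser_summable [of a d F] a assms by (intro summable_LIMSEQ) auto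
  \<comment> \<open>Convergence is q-adic: each single coefficient is eventually constant, which
    reduces the comparison to finite sums.\<close>
  then have ev: "\<forall>\<^sub>F N in sequentially. fps_nth (\<Sum>j<N. ?t j) n = fps_nth (suminf ?t) n" for n
    unfolding tendsto_fps_iff by blast
  have tail: "fps_X ^ Suc ?M dvd ?t j" if "j \<ge> 2" for j
  proof -
    have C: "fps_X ^ Cord a s (j * d) dvd Cser a F (j * d)"
      using Cser_lead [of "j * d"] that assms by (simp add: fps_eq_O_qmono_iff)
    have "Cord a s d \<le> Cord a s (j * d)" using that by (intro Cord_mono a s) simp
    moreover have "Suc (a * d) \<le> a * j * d"
    proof -
      have "a * d * 2 \<le> a * d * j" using that by (rule mult_le_mono2)
      moreover have "a * d \<noteq> 0" using a assms by simp
      moreover have "a * j * d = a * d * j" by (simp add: mult_ac)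
      ultimately show ?thesis by linarith
    qed
    ultimately show ?thesis by (rule_tac fps_X_power_dvd_mult [OF C dvd_refl]) linarith
  qed
  have t1: "fps_eq_O (?t 1) (qmono (Clead f d) ?M) (Suc ?M)"
    using fps_eq_O_qmono_mult [OF Cser_lead [OF assms], of "fps_X ^ (a * d)" 1 "a * d"]
    by (simp add: fps_eq_O_def)
  have rest: "fps_X ^ Suc ?M dvd suminf ?t - ?t 0 - ?t 1"
    unfolding fps_X_power_dvd_iff
  proof (intro allI impI)
    fix n assume n: "n < Suc ?M"
    \<comment> \<open>The bound 2 ensures that both split-off summands occur in the partial
      sum.\<close>
    obtain N where N: "fps_nth (\<Sum>j<N. ?t j) n = fps_nth (suminf ?t) n" "N \<ge> 2"
      using eventually_conj [OF ev [of n] eventually_ge_at_top [of 2]]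
      by (auto simp: eventually_sequentially)
    then have "{..<N} = {0, 1} \<union> {2..<N}" by auto
    then have split: "(\<Sum>j<N. ?t j) = ?t 0 + ?t 1 + (\<Sum>j=2..<N. ?t j)"
      by (simp add: sum.union_disjoint)
    have "fps_X ^ Suc ?M dvd (\<Sum>j=2..<N. ?t j)" by (intro dvd_sum tail) simp
    with n have z: "fps_nth (\<Sum>j=2..<N. ?t j) n = 0" unfolding fps_X_power_dvd_iff by blast
    show "fps_nth (suminf ?t - ?t 0 - ?t 1) n = 0"
      by (simp only: fps_sub_nth N(1) [symmetric] split fps_add_nth z) simp
  qed
  have "?t 1 + (suminf ?t - ?t 0 - ?t 1) = suminf ?t - Cser a F 0" by simp
  with fps_eq_O_absorb [OF t1 rest]
  have "fps_eq_O (suminf ?t - Cser a F 0) (qmono (Clead f d) ?M) (Suc ?M)" by (simp only:)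
  then have "fps_X ^ ?M dvd suminf ?t - Cser a F 0"
      and lead: "fps_nth (suminf ?t - Cser a F 0) ?M = Clead f d"
    unfolding fps_eq_O_qmono_iff by (rule conjunct1, rule conjunct2)
  then obtain h where h: "suminf ?t - Cser a F 0 = fps_X ^ ?M * h" by (elim dvdE)
  have h0: "fps_nth h 0 = Clead f d"
    using lead unfolding h by (simp add: fps_X_power_mult_nth)
  \<comment> \<open>The subtraction does not truncate, as a d >= a. Hence q^(1-a) cancels against a
    factor q^(a-1), leaving a genuine power series.\<close>
  define n where "n = ?M + 1 - a"
  have "a * 1 \<le> a * d" using assms by (rule mult_le_mono2)
  with a have n: "?M = (a - 1) + n" unfolding n_def by linarith
  have "1 - int a + int (a - 1) = 0" using a by linarith
  then have unit: "fls_X_intpow (1 - int a) * fps_to_fls (fps_X ^ (a - 1) :: 'a fps) = 1"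
    unfolding fps_to_fls_power fps_X_to_fls fls_X_power_conv_shift_1
      fls_X_intpow_times_fls_X_intpow by simp
  have "Pser a F d - Tser a F = fls_X_intpow (1 - int a) * fps_to_fls (suminf ?t - Cser a F 0)"
    unfolding Pser_def Tser_def Cser_0 fps_to_fls_minus by (rule right_diff_distrib [symmetric])
  also have "\<dots> = fps_to_fls (fps_X ^ n * h)"
    unfolding h n power_add fls_times_fps_to_fls mult.assoc [symmetric] unit by simp
  finally have "Pser a F d - Tser a F = fps_to_fls (fps_X ^ n * h)" .
  moreover have "fps_eq_O (fps_X ^ n * h) (qmono (Clead f d) n) (Suc n)"
    unfolding fps_eq_O_qmono_iff by (simp add: fps_X_power_mult_nth h0)
  ultimately show ?thesis
    unfolding fls_eq_O_def fps_eq_O_def n_def [symmetric] by (metis fps_to_fls_minus)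
qed

lemma Cser_Pser_expansions:
  "fps_eq_O (Cser a F (2 * l + 1)) (qmono ((- f) ^ l) (a * (s + 1) * l + 1)) (a * (s + 1) * l + 2)"
  "fps_eq_O (Cser a F (2 * l + 2)) (qmono (f * (- f) ^ l) (a * (s + 1) * l + a + s))
     (a * (s + 1) * l + a + s + 1)"
  "fls_eq_O (Pser a F (2 * l + 1) - Tser a F)
     (fps_to_fls (qmono ((- f) ^ l) (a * (s + 3) * l + 2))) (a * (s + 3) * l + 3)"
  "fls_eq_O (Pser a F (2 * l + 2) - Tser a F)
     (fps_to_fls (qmono (f * (- f) ^ l) (a * (s + 3) * l + 2 * a + s + 1)))
     (a * (s + 3) * l + 2 * a + s + 2)"
proof -
  show "fps_eq_O (Cser a F (2 * l + 1)) (qmono ((- f) ^ l) (a * (s + 1) * l + 1)) (a * (s + 1) * l + 2)"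
    using Cser_lead [of "2 * l + 1"] unfolding Cord_odd Clead_odd by simp
  show "fps_eq_O (Cser a F (2 * l + 2)) (qmono (f * (- f) ^ l) (a * (s + 1) * l + a + s))
     (a * (s + 1) * l + a + s + 1)"
    using Cser_lead [of "2 * l + 2"] unfolding Cord_even Clead_even by simp
  have "a * (s + 1) * l + 1 + a * (2 * l + 1) + 1 - a = a * (s + 3) * l + 2"
    by (simp add: algebra_simps)
  then show "fls_eq_O (Pser a F (2 * l + 1) - Tser a F)
     (fps_to_fls (qmono ((- f) ^ l) (a * (s + 3) * l + 2))) (a * (s + 3) * l + 3)"
    using Pser_minus_Tser [of "2 * l + 1"] unfolding Cord_odd Clead_odd
    by (simp only:) (simp add: numeral_3_eq_3)
  have "a * (s + 1) * l + a + s + a * (2 * l + 2) + 1 - a = a * (s + 3) * l + 2 * a + s + 1"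
    by (simp add: algebra_simps)
  then show "fls_eq_O (Pser a F (2 * l + 2) - Tser a F)
     (fps_to_fls (qmono (f * (- f) ^ l) (a * (s + 3) * l + 2 * a + s + 1)))
     (a * (s + 3) * l + 2 * a + s + 2)"
    using Pser_minus_Tser [of "2 * l + 2"] unfolding Cord_even Clead_even
    by (simp only:) simp
qed

end

theorem theorem2p5:
  fixes a s :: nat
  assumes "a \<ge> 2" and "s \<ge> 2"
  shows "(\<forall>(F :: 'k::field fps) f.
          fps_eq_O F (1 - fps_X + qmono f s) (s + 1) \<and> f \<noteq> 0 \<longrightarrow>
          (\<forall>l::nat.
            fps_eq_O (Cser a F (2 * l + 1))
              (qmono ((- f) ^ l) (a * (s + 1) * l + 1))
              (a * (s + 1) * l + 2)) \<and>
          (\<forall>l::nat.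
            fps_eq_O (Cser a F (2 * l + 2))
              (qmono (f * (- f) ^ l) (a * (s + 1) * l + a + s))
              (a * (s + 1) * l + a + s + 1)) \<and>
          (\<forall>l::nat. l \<ge> 1 \<longrightarrow>
            fls_eq_O (Pser a F (2 * l + 1) - Tser a F)
              (fps_to_fls (qmono ((- f) ^ l) (a * (s + 3) * l + 2)))
              (a * (s + 3) * l + 3)) \<and>
          (\<forall>l::nat.
            fls_eq_O (Pser a F (2 * l + 2) - Tser a F)
              (fps_to_fls (qmono (f * (- f) ^ l) (a * (s + 3) * l + 2 * a + s + 1)))
              (a * (s + 3) * l + 2 * a + s + 2)) \<and>
          (\<forall>l::nat. (- f) ^ l \<noteq> 0 \<and> f * (- f) ^ l \<noteq> 0)) \<and>
         (\<forall>(F :: 'r::comm_ring_1 fps) f.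
          fps_eq_O F (1 - fps_X + qmono f s) (s + 1) \<longrightarrow>
          (\<forall>l::nat.
            fps_eq_O (Cser a F (2 * l + 1))
              (qmono ((- f) ^ l) (a * (s + 1) * l + 1))
              (a * (s + 1) * l + 2)) \<and>
          (\<forall>l::nat.
            fps_eq_O (Cser a F (2 * l + 2))
              (qmono (f * (- f) ^ l) (a * (s + 1) * l + a + s))
              (a * (s + 1) * l + a + s + 1)) \<and>
          (\<forall>l::nat. l \<ge> 1 \<longrightarrow>
            fls_eq_O (Pser a F (2 * l + 1) - Tser a F)
              (fps_to_fls (qmono ((- f) ^ l) (a * (s + 3) * l + 2)))
              (a * (s + 3) * l + 3)) \<and>
          (\<forall>l::nat.
            fls_eq_O (Pser a F (2 * l + 2) - Tser a F)
              (fps_to_fls (qmono (f * (- f) ^ l) (a * (s + 3) * l + 2 * a + s + 1)))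
              (a * (s + 3) * l + 2 * a + s + 2)))"
  \<comment> \<open>Both halves are instances of the expansions over a commutative ring; the field
    enters through the nonvanishing of powers of f_s.\<close>
  by (intro conjI allI impI; (elim conjE)?)
    (rule Cser_Pser_expansions [OF assms], assumption | simp)+

end
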